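(* For every sequence $l=\{a_i;\ i=1,2,3,\dots\}$ of real numbers, the complete statistical fuzzy limit $L_{\mathrm{stat}}(l)=[\mathbb{R},\mu]$ of $l$, with membership function $a\mapsto\mu(a=\mathrm{stat}\text{-}\lim l)$, is a convex fuzzy set.
   Context: $\mathbb{N}=\{1,2,3,\dots\}$. For $K\subseteq\mathbb{N}$ put $K_n=\{k\in K: k\le n\}$; the asymptotic density of $K$ is $d(K)=\lim_{n\to\infty}\frac1n|K_n|$ whenever the limit exists. For a real $r\ge0$, $a=\mathrm{stat}\text{-}r\text{-}\lim l$ means that for every $\varepsilon>0$ the set $\{i\in\mathbb{N}: |a_i-a|\ge r+\varepsilon\}$ has density $0$. The upper statistical defect of statistical convergence of $l$ to $a\in\mathbb{R}$ is $\delta(a=\mathrm{stat}\text{-}\lim l)=\inf\{r\ge0: a=\mathrm{stat}\text{-}r\text{-}\lim l\}$ (equal to $+\infty$ if there is no such $r$). The upper statistical measure of statistical convergence of $l$ to $a$ is $\mu(a=\mathrm{stat}\text{-}\lim l)=\frac{1}{1+\delta(a=\mathrm{stat}\text{-}\lim l)}$ (equal to $0$ if the defect is $+\infty$). The complete statistical fuzzy limit $L_{\mathrm{stat}}(l)$ is the fuzzy set on $\mathbb{R}$ with membership function $a\mapsto\mu(a=\mathrm{stat}\text{-}\lim l)$. A fuzzy set $[A,\mu]$ (here $A=\mathbb{R}$) is convex if $\mu(\lambda x+(1-\lambda)z)\ge\min\{\mu(x),\mu(z)\}$ for all $x,z$ and all $\lambda\in[0,1]$. *)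

theory Defs
  imports "HOL-Analysis.Analysis"
begin

text \<open>
  Sequences \<open>a\<^sub>1, a\<^sub>2, a\<^sub>3, \<dots>\<close> are functions on \<open>nat\<close> whose value at \<open>0\<close> is ignored;
  sets of indices are subsets of \<open>{1..}\<close>.
\<close>

text \<open>The limit exists and equals \<open>d\<close>.\<close>

definition has_asymptotic_density :: "nat set \<Rightarrow> real \<Rightarrow> bool" where
  "has_asymptotic_density K d \<longleftrightarrow>
     (\<lambda>n. (1 / real n) * real (card {k \<in> K. 1 \<le> k \<and> k \<le> n})) \<longlonglongrightarrow> d"

definition stat_r_lim :: "real \<Rightarrow> (nat \<Rightarrow> real) \<Rightarrow> real \<Rightarrow> bool" where
  "stat_r_lim r l a \<longleftrightarrow>
     (\<forall>\<epsilon>>0. has_asymptotic_density {i. 1 \<le> i \<and> \<bar>l i - a\<bar> \<ge> r + \<epsilon>} 0)"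

text \<open>The infimum is taken in the extended reals, so it is \<open>\<infinity>\<close> when no such \<open>r\<close> exists.\<close>

definition stat_defect :: "(nat \<Rightarrow> real) \<Rightarrow> real \<Rightarrow> ereal" where
  "stat_defect l a = Inf {ereal r | r. 0 \<le> r \<and> stat_r_lim r l a}"

definition stat_measure :: "(nat \<Rightarrow> real) \<Rightarrow> real \<Rightarrow> real" where
  "stat_measure l a =
     (if stat_defect l a = \<infinity> then 0 else 1 / (1 + real_of_ereal (stat_defect l a)))"

text \<open>
  A fuzzy set \<open>[A, \<mu>]\<close> is given by its membership function \<open>\<mu>\<close>, the ground set \<open>A\<close> being the
  whole type of its arguments.
\<close>

definition fuzzy_set :: "('a \<Rightarrow> real) \<Rightarrow> bool" where
  "fuzzy_set \<mu> \<longleftrightarrow> (\<forall>x. 0 \<le> \<mu> x \<and> \<mu> x \<le> 1)"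

definition convex_fuzzy_set :: "('a::real_vector \<Rightarrow> real) \<Rightarrow> bool" where
  "convex_fuzzy_set \<mu> \<longleftrightarrow> fuzzy_set \<mu> \<and>
     (\<forall>x z t. 0 \<le> t \<and> t \<le> 1 \<longrightarrow> \<mu> (t *\<^sub>R x + (1 - t) *\<^sub>R z) \<ge> min (\<mu> x) (\<mu> z))"

definition complete_stat_fuzzy_limit :: "(nat \<Rightarrow> real) \<Rightarrow> (real \<Rightarrow> real)" where
  "complete_stat_fuzzy_limit l = (\<lambda>a. stat_measure l a)"

end

theory Submission
  imports Defs
begin

text \<open>
  The membership function is a decreasing function of the defect, so convexity of the fuzzy limit
  is quasiconvexity of the defect: at a point \<open>y\<close> between \<open>x\<close> and \<open>z\<close> the defect is at most the
  larger of the defects at \<open>x\<close> and \<open>z\<close> (\<open>stat_defect_quasiconvex\<close>). This holds because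
  \<open>b \<mapsto> \<bar>a - b\<bar>\<close> is convex: a term of the sequence whose distance from \<open>y\<close> is at least \<open>s\<close> is at
  distance at least \<open>s\<close> from \<open>x\<close> or from \<open>z\<close>. The indices that are exceptional for \<open>y\<close> thus lie in
  the union of those exceptional for \<open>x\<close> and for \<open>z\<close>, and sets of density zero form an ideal.
\<close>

text \<open>The counting functions of \<open>A\<close> and \<open>B\<close> add up to a bound for that of \<open>C\<close>, which is squeezed
  to zero.\<close>

lemma density_zero_subset_Un:
  assumes A: "has_asymptotic_density A 0" and B: "has_asymptotic_density B 0"
    and sub: "C \<subseteq> A \<union> B"
  shows "has_asymptotic_density C 0"
proof -
  define c where "c K n = card {k \<in> K. 1 \<le> k \<and> k \<le> n}" for K :: "nat set" and n
  have bound: "c C n \<le> c A n + c B n" for n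
  proof -
    have "c C n \<le> card ({k \<in> A. 1 \<le> k \<and> k \<le> n} \<union> {k \<in> B. 1 \<le> k \<and> k \<le> n})"
      unfolding c_def using sub by (intro card_mono) auto
    also have "\<dots> \<le> c A n + c B n"
      unfolding c_def by (rule card_Un_le)
    finally show ?thesis .
  qed
  have "(\<lambda>n. 1 / real n * real (c A n) + 1 / real n * real (c B n)) \<longlonglongrightarrow> 0 + 0"
    using A B unfolding has_asymptotic_density_def c_def by (rule tendsto_add)
  then have lim: "(\<lambda>n. 1 / real n * real (c A n) + 1 / real n * real (c B n)) \<longlonglongrightarrow> 0"
    by simp
  have "1 / real n * real (c C n) \<le> 1 / real n * real (c A n) + 1 / real n * real (c B n)"
    for n
  proof -
    have "1 / real n * real (c C n) \<le> 1 / real n * real (c A n + c B n)"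
      by (intro mult_left_mono of_nat_mono bound) auto
    then show ?thesis by (simp add: distrib_left add_divide_distrib)
  qed
  then have "(\<lambda>n. 1 / real n * real (c C n)) \<longlonglongrightarrow> 0"
    by (intro tendsto_sandwich[OF _ _ tendsto_const lim] always_eventually) auto
  then show ?thesis
    unfolding has_asymptotic_density_def c_def .
qed

lemma abs_diff_convex_combination_le:
  fixes a x z t :: real
  assumes "0 \<le> t" "t \<le> 1"
  shows "\<bar>a - (t * x + (1 - t) * z)\<bar> \<le> max \<bar>a - x\<bar> \<bar>a - z\<bar>"
proof -
  have "a - (t * x + (1 - t) * z) = t * (a - x) + (1 - t) * (a - z)"
    by (simp add: algebra_simps)
  also have "\<bar>\<dots>\<bar> \<le> t * \<bar>a - x\<bar> + (1 - t) * \<bar>a - z\<bar>"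
    using assms abs_triangle_ineq[of "t * (a - x)" "(1 - t) * (a - z)"] by (simp add: abs_mult)
  also have "\<dots> \<le> max \<bar>a - x\<bar> \<bar>a - z\<bar>"
    using assms by (intro convex_bound_le) auto
  finally show ?thesis .
qed

lemma stat_r_lim_convex_combination:
  assumes x: "stat_r_lim r l x" and z: "stat_r_lim s l z" and t: "0 \<le> t" "t \<le> 1"
  shows "stat_r_lim (max r s) l (t * x + (1 - t) * z)"
  unfolding stat_r_lim_def
proof (intro allI impI)
  fix \<epsilon> :: real assume "\<epsilon> > 0"
  have "has_asymptotic_density {i. 1 \<le> i \<and> \<bar>l i - x\<bar> \<ge> r + \<epsilon>} 0"
    and "has_asymptotic_density {i. 1 \<le> i \<and> \<bar>l i - z\<bar> \<ge> s + \<epsilon>} 0"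
    using x z \<open>\<epsilon> > 0\<close> unfolding stat_r_lim_def by blast+
  moreover have "{i. 1 \<le> i \<and> \<bar>l i - (t * x + (1 - t) * z)\<bar> \<ge> max r s + \<epsilon>} \<subseteq>
      {i. 1 \<le> i \<and> \<bar>l i - x\<bar> \<ge> r + \<epsilon>} \<union> {i. 1 \<le> i \<and> \<bar>l i - z\<bar> \<ge> s + \<epsilon>}"
  proof -
    have "r + \<epsilon> \<le> \<bar>l i - x\<bar> \<or> s + \<epsilon> \<le> \<bar>l i - z\<bar>"
      if "max r s + \<epsilon> \<le> \<bar>l i - (t * x + (1 - t) * z)\<bar>" for i
      using that abs_diff_convex_combination_le[OF t, of "l i" x z] by linarith
    then show ?thesis by blast
  qed
  ultimately show "has_asymptotic_density
      {i. 1 \<le> i \<and> \<bar>l i - (t * x + (1 - t) * z)\<bar> \<ge> max r s + \<epsilon>} 0"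
    by (rule density_zero_subset_Un)
qed

text \<open>If the defect at the intermediate point exceeded both others, there would be radii
  \<open>r\<close> and \<open>s\<close> strictly below it that are admissible at the two end points, and \<open>max r s\<close> would be
  admissible in between, contradicting the infimum there.\<close>

lemma stat_defect_quasiconvex:
  assumes t: "0 \<le> t" "t \<le> 1"
  shows "stat_defect l (t * x + (1 - t) * z) \<le> max (stat_defect l x) (stat_defect l z)"
proof (rule ccontr)
  let ?y = "t * x + (1 - t) * z"
  assume "\<not> ?thesis"
  then have "stat_defect l x < stat_defect l ?y" "stat_defect l z < stat_defect l ?y"
    by (auto simp: le_max_iff_disj not_le)
  then obtain r s where r: "0 \<le> r" "stat_r_lim r l x" "ereal r < stat_defect l ?y"
    and s: "0 \<le> s" "stat_r_lim s l z" "ereal s < stat_defect l ?y"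
    unfolding stat_defect_def[of l x] stat_defect_def[of l z] Inf_less_iff by blast
  have "stat_defect l ?y \<le> ereal (max r s)"
    unfolding stat_defect_def
    using r(1) stat_r_lim_convex_combination[OF r(2) s(2) t]
    by (intro Inf_lower) (auto simp del: ereal_max)
  then show False
    using r(3) s(3) by (simp add: max_def split: if_splits)
qed

lemma stat_defect_nonneg: "0 \<le> stat_defect l a"
  unfolding stat_defect_def by (rule Inf_greatest) auto

lemma stat_measure_nonneg: "0 \<le> stat_measure l a"
  unfolding stat_measure_def using stat_defect_nonneg[of l a]
  by (simp add: real_of_ereal_pos)

lemma stat_measure_le_1: "stat_measure l a \<le> 1"
  unfolding stat_measure_def using real_of_ereal_pos[OF stat_defect_nonneg[of l a]]
  by (simp add: divide_le_eq_1)

lemma stat_measure_antimono: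
  assumes "stat_defect l a \<le> stat_defect l b"
  shows "stat_measure l b \<le> stat_measure l a"
proof (cases "stat_defect l b = \<infinity>")
  case True
  then show ?thesis
    using stat_measure_nonneg[of l a] by (simp add: stat_measure_def[of l b])
next
  case False
  then have "real_of_ereal (stat_defect l a) \<le> real_of_ereal (stat_defect l b)"
    using assms stat_defect_nonneg[of l a] by (intro real_of_ereal_positive_mono) auto
  moreover have "stat_defect l a \<noteq> \<infinity>"
    using False assms by auto
  ultimately show ?thesis
    using False real_of_ereal_pos[OF stat_defect_nonneg[of l a]]
    by (auto simp: stat_measure_def intro!: divide_left_mono)
qed

theorem theorem3p4:
  fixes l :: "nat \<Rightarrow> real"
  shows "convex_fuzzy_set (complete_stat_fuzzy_limit l)"
proof -
  have "min (stat_measure l x) (stat_measure l z) \<le> stat_measure l (t * x + (1 - t) * z)"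
    if t: "0 \<le> t" "t \<le> 1" for x z t
  proof -
    consider "stat_defect l (t * x + (1 - t) * z) \<le> stat_defect l x"
      | "stat_defect l (t * x + (1 - t) * z) \<le> stat_defect l z"
      using stat_defect_quasiconvex[OF t, of l x z] by (auto simp: le_max_iff_disj)
    then show ?thesis
      by cases (auto dest: stat_measure_antimono simp: min_le_iff_disj)
  qed
  then show ?thesis
    by (simp add: convex_fuzzy_set_def fuzzy_set_def complete_stat_fuzzy_limit_def
        stat_measure_nonneg stat_measure_le_1)
qed

end
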